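(* There exists a stochastic finite-state recognizer (SR) such that the process language it recognizes is not generated by any (finite-state) stochastic deterministic finite-state generator (SDG).
   Context: A stochastic language over a finite alphabet $\Sigma$ is given by a word distribution $\Pr:\Sigma^*\to[0,1]$ with $\sum_{w\in\Sigma^L}\Pr(w)=1$ for all $L\ge1$. It is a process language if it is subword closed (every contiguous subword of a word of positive probability has positive probability) and $\Pr(w)\ge\Pr(w\sigma)$ for all words $w$ and symbols $\sigma$. A stochastic finite-state recognizer (SR) consists of a finite state set $S$ with a start state $s_0$, a finite input alphabet $X$, and nonnegative $|S|\times|S|$ matrices $T(x)$, $x\in X$, such that $\sum_{x\in X}T(x)$ is (row-)stochastic. It accepts the word $x_0\cdots x_{L-1}$ with probability $\langle\pi^0|T(x_0)\cdots T(x_{L-1})|\eta\rangle$, where $\langle\pi^0|=(1,0,\dots,0)$ is concentrated on $s_0$ and $|\eta\rangle$ is the all-ones column vector; it recognizes the language whose word distribution equals these acceptance probabilities. A stochastic finite-state generator (SG) is defined by the same kind of data, with matrices $T(y)$ indexed by the symbols $y$ of a finite output alphabet $Y$ and with $\sum_{y\in Y}T(y)$ stochastic; it generates the word distribution $\Pr(y_0\cdots y_{L-1})=\langle\pi^0|T(y_0)\cdots T(y_{L-1})|\eta\rangle$. An SDG is an SG in which each $T(y)$ has at most one nonzero entry per row. *)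

theory Defs
  imports "HOL-Library.Sublist" Complex_Main "Jordan_Normal_Form.Matrix"
begin

definition stochastic_language :: "'a set \<Rightarrow> ('a list \<Rightarrow> real) \<Rightarrow> bool" where
  "stochastic_language \<Sigma> P \<longleftrightarrow>
     finite \<Sigma> \<and>
     (\<forall>w\<in>lists \<Sigma>. 0 \<le> P w \<and> P w \<le> 1) \<and>
     (\<forall>L\<ge>1. (\<Sum>w | w \<in> lists \<Sigma> \<and> length w = L. P w) = 1)"

definition process_language :: "'a set \<Rightarrow> ('a list \<Rightarrow> real) \<Rightarrow> bool" where
  "process_language \<Sigma> P \<longleftrightarrow>
     stochastic_language \<Sigma> P \<and>
     (\<forall>w\<in>lists \<Sigma>. \<forall>v. P w > 0 \<and> sublist v w \<longrightarrow> P v > 0) \<and>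
     (\<forall>w\<in>lists \<Sigma>. \<forall>\<sigma>\<in>\<Sigma>. P w \<ge> P (w @ [\<sigma>]))"

(* The state set is {0..<num_states}, with start state 0.
   Values of trans outside the alphabet are irrelevant. *)
record 'a machine =
  num_states :: nat
  alphabet :: "'a set"
  trans :: "'a \<Rightarrow> real mat"

definition nonneg_matrix :: "real mat \<Rightarrow> bool" where
  "nonneg_matrix A \<longleftrightarrow> (\<forall>i<dim_row A. \<forall>j<dim_col A. 0 \<le> A $$ (i, j))"

definition row_stochastic :: "real mat \<Rightarrow> bool" where
  "row_stochastic A \<longleftrightarrow> nonneg_matrix A \<and> (\<forall>i<dim_row A. (\<Sum>j<dim_col A. A $$ (i, j)) = 1)"

definition total_matrix :: "'a machine \<Rightarrow> real mat" where
  "total_matrix M = mat (num_states M) (num_states M) (\<lambda>ij. \<Sum>x\<in>alphabet M. trans M x $$ ij)"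

definition stochastic_machine :: "'a machine \<Rightarrow> bool" where
  "stochastic_machine M \<longleftrightarrow>
     num_states M > 0 \<and>
     finite (alphabet M) \<and>
     (\<forall>x\<in>alphabet M. trans M x \<in> carrier_mat (num_states M) (num_states M)
                        \<and> nonneg_matrix (trans M x)) \<and>
     row_stochastic (total_matrix M)"

(* Recognizers and generators are given by the same data; only the reading of the
   alphabet (input or output) differs. *)
abbreviation (input) stochastic_recognizer :: "'a machine \<Rightarrow> bool" where
  "stochastic_recognizer \<equiv> stochastic_machine"

abbreviation (input) stochastic_generator :: "'a machine \<Rightarrow> bool" where
  "stochastic_generator \<equiv> stochastic_machine"

definition stochastic_deterministic_generator :: "'a machine \<Rightarrow> bool" where
  "stochastic_deterministic_generator G \<longleftrightarrow>
     stochastic_generator G \<and>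
     (\<forall>y\<in>alphabet G. \<forall>i<num_states G.
        card {j. j < num_states G \<and> trans G y $$ (i, j) \<noteq> 0} \<le> 1)"

definition word_matrix :: "'a machine \<Rightarrow> 'a list \<Rightarrow> real mat" where
  "word_matrix M w = foldr (\<lambda>x A. trans M x * A) w (1\<^sub>m (num_states M))"

(* The word distribution is extended by 0 to words using symbols outside the alphabet, so that
   distributions of machines with different alphabets can be compared by equality. *)
definition word_prob :: "'a machine \<Rightarrow> 'a list \<Rightarrow> real" where
  "word_prob M w =
     (if w \<in> lists (alphabet M)
      then unit_vec (num_states M) 0 \<bullet> (word_matrix M w *\<^sub>v vec (num_states M) (\<lambda>_. 1))
      else 0)"

definition recognizes :: "'a machine \<Rightarrow> ('a list \<Rightarrow> real) \<Rightarrow> bool" where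
  "recognizes M P \<longleftrightarrow> stochastic_recognizer M \<and> P = word_prob M"

definition generates :: "'a machine \<Rightarrow> ('a list \<Rightarrow> real) \<Rightarrow> bool" where
  "generates G P \<longleftrightarrow> stochastic_generator G \<and> P = word_prob G"

end

theory Submission
  imports Defs
begin

text \<open>In a deterministic generator, the probability of reading a symbol given the past is a row sum of the
  transition matrix at the state reached, so it takes only finitely many values. The recognizer
  below has a nontrivial Jordan block as its matrix for the symbol 0; hence the word $0^n$ has
  probability $(n + 2) / 2^{n+1}$, and the conditional probability $(n + 3) / (2 (n + 2))$ of one
  more 0 takes infinitely many values. All its words have positive probability, so closure
  under subwords is automatic.\<close>

text \<open>Letting the start state vary makes recursion on the first letter possible: after one
  letter the rest of the word is read from another state. Facts about \<open>word_prob\<close>,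
  where the start state is 0, therefore come from inductions over all states.\<close>

definition state_prob :: "'a machine \<Rightarrow> 'a list \<Rightarrow> nat \<Rightarrow> real" where
  "state_prob M w i = (word_matrix M w *\<^sub>v vec (num_states M) (\<lambda>_. 1)) $ i"

lemma word_matrix_carrier:
  assumes "stochastic_machine M" "w \<in> lists (alphabet M)"
  shows "word_matrix M w \<in> carrier_mat (num_states M) (num_states M)"
  using assms(2)
proof (induction w)
  case Nil
  then show ?case by (simp add: word_matrix_def)
next
  case (Cons x w)
  then have "trans M x \<in> carrier_mat (num_states M) (num_states M)"
    using assms(1) by (auto simp: stochastic_machine_def)
  with Cons show ?case by (auto simp: word_matrix_def)
qed

lemma word_prob_eq_state_prob:
  assumes "stochastic_machine M" "w \<in> lists (alphabet M)"
  shows "word_prob M w = state_prob M w 0"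
  using word_matrix_carrier[OF assms] assms
  by (simp add: word_prob_def state_prob_def stochastic_machine_def)

lemma state_prob_Nil: "i < num_states M \<Longrightarrow> state_prob M [] i = 1"
  by (simp add: state_prob_def word_matrix_def)

lemma state_prob_Cons:
  assumes M: "stochastic_machine M" and x: "x \<in> alphabet M" and w: "w \<in> lists (alphabet M)"
    and i: "i < num_states M"
  shows "state_prob M (x # w) i = (\<Sum>j<num_states M. trans M x $$ (i, j) * state_prob M w j)"
proof -
  let ?v = "word_matrix M w *\<^sub>v vec (num_states M) (\<lambda>_. 1)"
  have T: "trans M x \<in> carrier_mat (num_states M) (num_states M)"
    using M x by (auto simp: stochastic_machine_def)
  have W: "word_matrix M w \<in> carrier_mat (num_states M) (num_states M)"
    using word_matrix_carrier[OF M w] .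
  have "word_matrix M (x # w) *\<^sub>v vec (num_states M) (\<lambda>_. 1) = trans M x *\<^sub>v ?v"
    using T W by (simp add: word_matrix_def assoc_mult_mat_vec[of _ _ "num_states M" _ "num_states M"])
  then show ?thesis
    using T W i by (auto simp: state_prob_def scalar_prod_def lessThan_atLeast0 intro!: sum.cong)
qed

lemma trans_nonneg:
  assumes "stochastic_machine M" "x \<in> alphabet M" "i < num_states M" "j < num_states M"
  shows "0 \<le> trans M x $$ (i, j)"
  using assms by (auto simp: stochastic_machine_def nonneg_matrix_def)

lemma sum_trans:
  assumes "stochastic_machine M" "i < num_states M"
  shows "(\<Sum>x\<in>alphabet M. \<Sum>j<num_states M. trans M x $$ (i, j)) = 1"
proof -
  have "(\<Sum>j<num_states M. \<Sum>x\<in>alphabet M. trans M x $$ (i, j)) = 1"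
    using assms by (simp add: stochastic_machine_def row_stochastic_def total_matrix_def)
  then show ?thesis by (subst sum.swap)
qed

lemma state_prob_nonneg:
  assumes M: "stochastic_machine M" and w: "w \<in> lists (alphabet M)" and i: "i < num_states M"
  shows "0 \<le> state_prob M w i"
  using w i
proof (induction w arbitrary: i)
  case Nil
  then show ?case by (simp add: state_prob_Nil)
next
  case (Cons x w)
  then show ?case
    by (auto simp: state_prob_Cons[OF M] intro!: sum_nonneg mult_nonneg_nonneg trans_nonneg[OF M])
qed

text \<open>Peeling off first letters with nonnegative weights reduces the claim to the empty word.
  There the probability of the single letter is one summand of a row sum of the total matrix, which
  is 1.\<close>

lemma state_prob_snoc_le:
  assumes M: "stochastic_machine M" and w: "w \<in> lists (alphabet M)" and x: "x \<in> alphabet M"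
    and i: "i < num_states M"
  shows "state_prob M (w @ [x]) i \<le> state_prob M w i"
  using w i
proof (induction w arbitrary: i)
  case Nil
  have "state_prob M [x] i = (\<Sum>j<num_states M. trans M x $$ (i, j))"
    using M x Nil by (simp add: state_prob_Cons state_prob_Nil)
  also have "\<dots> \<le> (\<Sum>x\<in>alphabet M. \<Sum>j<num_states M. trans M x $$ (i, j))"
    using M x Nil
    by (intro member_le_sum) (auto simp: stochastic_machine_def nonneg_matrix_def intro!: sum_nonneg)
  finally show ?case using M Nil by (simp add: sum_trans state_prob_Nil)
next
  case (Cons y w)
  then show ?case using x
    by (auto simp: state_prob_Cons[OF M] intro!: sum_mono mult_left_mono trans_nonneg[OF M])
qed

lemma state_prob_le_1:
  assumes M: "stochastic_machine M" and w: "w \<in> lists (alphabet M)" and i: "i < num_states M"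
  shows "state_prob M w i \<le> 1"
  using w
proof (induction w rule: rev_induct)
  case Nil
  then show ?case using i by (simp add: state_prob_Nil)
next
  case (snoc x w)
  then show ?case using state_prob_snoc_le[OF M _ _ i, of w x] by auto
qed

text \<open>Split off the first letter and sum over the remaining word innermost: the induction
  hypothesis, at each successor state, turns that sum into 1, and a row sum of the total matrix
  remains.\<close>

lemma sum_state_prob:
  assumes M: "stochastic_machine M" and i: "i < num_states M"
  shows "(\<Sum>w | w \<in> lists (alphabet M) \<and> length w = L. state_prob M w i) = 1"
  using i
proof (induction L arbitrary: i)
  case 0
  have "{w. w \<in> lists (alphabet M) \<and> length w = 0} = {[]}" by auto
  then show ?case using 0 by (simp add: state_prob_Nil)
next
  case (Suc L)
  let ?W = "\<lambda>L. {w. w \<in> lists (alphabet M) \<and> length w = L}"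
  have "bij_betw (\<lambda>(x, w). x # w) (alphabet M \<times> ?W L) (?W (Suc L))"
    by (rule bij_betw_byWitness[where f' = "\<lambda>w. (hd w, tl w)"]) (auto simp: length_Suc_conv)
  then have "(\<Sum>w\<in>?W (Suc L). state_prob M w i)
      = (\<Sum>(x, w)\<in>alphabet M \<times> ?W L. state_prob M (x # w) i)"
    by (simp add: sum.reindex_bij_betw[symmetric] case_prod_unfold)
  also have "\<dots> = (\<Sum>x\<in>alphabet M. \<Sum>w\<in>?W L. \<Sum>j<num_states M.
      trans M x $$ (i, j) * state_prob M w j)"
    using M Suc.prems by (simp add: sum.cartesian_product[symmetric] state_prob_Cons)
  also have "\<dots> = (\<Sum>x\<in>alphabet M. \<Sum>j<num_states M. \<Sum>w\<in>?W L.
      trans M x $$ (i, j) * state_prob M w j)"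
    by (intro sum.cong refl sum.swap)
  also have "\<dots> = (\<Sum>x\<in>alphabet M. \<Sum>j<num_states M. trans M x $$ (i, j))"
    by (simp add: sum_distrib_left[symmetric] Suc.IH)
  finally show ?case using M Suc.prems by (simp add: sum_trans)
qed

text \<open>Positivity serves subword closure, since a subword of a word over the alphabet is again
  such a word. The other conditions hold for every stochastic machine.\<close>

lemma process_language_word_prob:
  assumes M: "stochastic_machine M"
    and pos: "\<And>w. w \<in> lists (alphabet M) \<Longrightarrow> 0 < word_prob M w"
  shows "process_language (alphabet M) (word_prob M)"
proof -
  have 0: "0 < num_states M" and fin: "finite (alphabet M)"
    using M by (auto simp: stochastic_machine_def)
  note eq = word_prob_eq_state_prob[OF M]
  have "stochastic_language (alphabet M) (word_prob M)"
    using fin state_prob_nonneg[OF M _ 0] state_prob_le_1[OF M _ 0] sum_state_prob[OF M 0]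
    by (simp add: stochastic_language_def eq)
  moreover have "0 < word_prob M v" if "w \<in> lists (alphabet M)" "sublist v w" for v w
    using that by (intro pos) (auto dest: set_mono_sublist)
  moreover have "word_prob M (w @ [x]) \<le> word_prob M w"
    if "w \<in> lists (alphabet M)" "x \<in> alphabet M" for w x
  proof -
    have "w @ [x] \<in> lists (alphabet M)" using that by simp
    with that show ?thesis using state_prob_snoc_le[OF M _ _ 0] by (simp only: eq)
  qed
  ultimately show ?thesis unfolding process_language_def by blast
qed

text \<open>At most one term of the sum in \<open>state_prob_Cons\<close> survives. The successor
  \<open>j\<close> depends on \<open>i\<close> and \<open>y\<close> but not on \<open>w\<close>, so
  a path can be followed before its continuation is known.\<close>

lemma deterministic_row:
  assumes G: "stochastic_deterministic_generator G" and y: "y \<in> alphabet G"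
    and i: "i < num_states G"
  obtains j where "j < num_states G"
    "\<And>w. w \<in> lists (alphabet G) \<Longrightarrow> state_prob G (y # w) i = trans G y $$ (i, j) * state_prob G w j"
proof -
  have M: "stochastic_machine G" using G by (simp add: stochastic_deterministic_generator_def)
  let ?S = "{j. j < num_states G \<and> trans G y $$ (i, j) \<noteq> 0}"
  have "card ?S \<le> Suc 0"
    using G y i by (simp add: stochastic_deterministic_generator_def)
  then have unique: "j = k" if "j \<in> ?S" "k \<in> ?S" for j k
    using that by (simp add: card_le_Suc0_iff_eq)
  obtain j where j: "j < num_states G" "\<And>k. k < num_states G \<Longrightarrow> k \<noteq> j \<Longrightarrow> trans G y $$ (i, k) = 0"
  proof (cases "?S = {}")
    \<comment> \<open>In a zero row every state can serve as successor, because the factor in front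
      is 0.\<close>
    case True
    then show ?thesis using that[of i] i by blast
  next
    case False
    then obtain j where "j \<in> ?S" by blast
    then show ?thesis using that[of j] unique by blast
  qed
  show ?thesis
  proof (rule that[of j])
    fix w assume "w \<in> lists (alphabet G)"
    then have "state_prob G (y # w) i = (\<Sum>k<num_states G. trans G y $$ (i, k) * state_prob G w k)"
      using M y i by (simp add: state_prob_Cons)
    also have "\<dots> = (\<Sum>k\<in>{j}. trans G y $$ (i, k) * state_prob G w k)"
      using j by (intro sum.mono_neutral_right) auto
    finally show "state_prob G (y # w) i = trans G y $$ (i, j) * state_prob G w j" by simp
  qed (use j in auto)
qed

text \<open>The letters read so far determine a state \<open>i\<close>, so the conditional
  probability of one more \<open>y\<close> is among the finitely many numbers
  \<open>state_prob G [y] i\<close>. The product form also covers words of probability 0.\<close>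

lemma deterministic_replicate:
  assumes G: "stochastic_deterministic_generator G" and y: "y \<in> alphabet G"
  obtains i where "i < num_states G"
    "word_prob G (replicate (Suc n) y) = word_prob G (replicate n y) * state_prob G [y] i"
proof -
  have M: "stochastic_machine G" using G by (simp add: stochastic_deterministic_generator_def)
  \<comment> \<open>Here \<open>c\<close> is the product of the entries along the path. It is chosen
    before \<open>m\<close>: the instance m = 0 later identifies it as the probability of the
    prefix, and m = 1 gives the prefix with one more letter.\<close>
  have "\<exists>i<num_states G. \<exists>c. \<forall>m.
      state_prob G (replicate (n + m) y) 0 = c * state_prob G (replicate m y) i" for n
  proof (induction n)
    case 0
    show ?case using M by (intro exI[of _ 0] conjI exI[of _ 1]) (auto simp: stochastic_machine_def)
  next
    case (Suc n)
    then obtain i c where i: "i < num_states G"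
      and c: "\<And>m. state_prob G (replicate (n + m) y) 0 = c * state_prob G (replicate m y) i"
      by blast
    obtain j where j: "j < num_states G" "\<And>w. w \<in> lists (alphabet G) \<Longrightarrow>
        state_prob G (y # w) i = trans G y $$ (i, j) * state_prob G w j"
      using deterministic_row[OF G y i] by blast
    have "state_prob G (replicate (Suc n + m) y) 0
        = c * trans G y $$ (i, j) * state_prob G (replicate m y) j" for m
    proof -
      have "replicate m y \<in> lists (alphabet G)" using y by auto
      from j(2)[OF this] show ?thesis using c[of "Suc m"] by simp
    qed
    with j(1) show ?case by blast
  qed
  then obtain i c where i: "i < num_states G"
    and c: "\<And>m. state_prob G (replicate (n + m) y) 0 = c * state_prob G (replicate m y) i"
    by blast
  have eq: "word_prob G (replicate k y) = state_prob G (replicate k y) 0" for k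
    by (rule word_prob_eq_state_prob[OF M]) (use y in auto)
  have "word_prob G (replicate (Suc n) y) = word_prob G (replicate n y) * state_prob G [y] i"
    unfolding eq using c[of 0] c[of 1] i by (simp add: state_prob_Nil)
  with i show ?thesis by (rule that)
qed

text \<open>The matrix for 0 is, up to scaling the off-diagonal entry, a Jordan block with
  eigenvalue 1/2. The matrix for 1 supplies the mass missing in each row and always leads back to
  state 0.\<close>

definition jordan_recognizer :: "nat machine" where
  "jordan_recognizer = \<lparr>num_states = 2, alphabet = {0, 1},
     trans = (\<lambda>x. if x = 0 then mat_of_rows_list 2 [[1/2, 1/4], [0, 1/2]]
                  else mat_of_rows_list 2 [[1/4, 0], [1/2, 0]])\<rparr>"

text \<open>The letter 1 appears as \<open>Suc 0\<close>, the form into which the simplifier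
  rewrites it.\<close>

lemma jordan_recognizer_simps [simp]:
  "num_states jordan_recognizer = 2"
  "alphabet jordan_recognizer = {0, 1}"
  "trans jordan_recognizer 0 = mat_of_rows_list 2 [[1/2, 1/4], [0, 1/2]]"
  "trans jordan_recognizer (Suc 0) = mat_of_rows_list 2 [[1/4, 0], [1/2, 0]]"
  by (simp_all add: jordan_recognizer_def)

lemma stochastic_jordan_recognizer: "stochastic_machine jordan_recognizer"
  by (simp add: stochastic_machine_def nonneg_matrix_def row_stochastic_def total_matrix_def
      mat_of_rows_list_def All_less_Suc numeral_2_eq_2)

lemma state_prob_jordan_recognizer:
  assumes "w \<in> lists {0, 1}"
  shows "state_prob jordan_recognizer (0 # w) 0
      = state_prob jordan_recognizer w 0 / 2 + state_prob jordan_recognizer w 1 / 4"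
    and "state_prob jordan_recognizer (0 # w) 1 = state_prob jordan_recognizer w 1 / 2"
    and "state_prob jordan_recognizer (1 # w) 0 = state_prob jordan_recognizer w 0 / 4"
    and "state_prob jordan_recognizer (1 # w) 1 = state_prob jordan_recognizer w 0 / 2"
  using assms
  by (simp_all add: state_prob_Cons[OF stochastic_jordan_recognizer] mat_of_rows_list_def
      numeral_2_eq_2)

lemma state_prob_jordan_recognizer_pos:
  assumes "w \<in> lists {0, 1}"
  shows "0 < state_prob jordan_recognizer w 0 \<and> 0 < state_prob jordan_recognizer w 1"
  using assms
proof (induction w)
  case Nil
  then show ?case by (simp add: state_prob_Nil)
next
  case (Cons x w)
  then consider "x = 0" | "x = 1" by blast
  then show ?case
    using Cons state_prob_jordan_recognizer[of w] by cases auto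
qed

text \<open>The n-th power of the block has diagonal entries 1/2^n and off-diagonal entry (n/4) /
  2^(n-1); the two values are its row sums.\<close>

lemma state_prob_jordan_recognizer_replicate:
  "state_prob jordan_recognizer (replicate n 0) 0 = (real n + 2) / 2 ^ Suc n \<and>
   state_prob jordan_recognizer (replicate n 0) 1 = 1 / 2 ^ n"
proof (induction n)
  case 0
  then show ?case by (simp add: state_prob_Nil)
next
  case (Suc n)
  have "replicate n 0 \<in> lists {0, 1 :: nat}" by auto
  note step = state_prob_jordan_recognizer[OF this]
  show ?case
    \<comment> \<open>Without \<open>One_nat_def\<close> the state index 1 keeps the form it has in
      \<open>step\<close>.\<close>
    using Suc by (simp add: step field_simps del: One_nat_def)
qed

theorem corollary4:
  shows "\<exists>(M :: nat machine) P.
           stochastic_recognizer M \<and> recognizes M P \<and> process_language (alphabet M) P \<and>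
           \<not> (\<exists>G :: nat machine. stochastic_deterministic_generator G \<and> generates G P)"
proof -
  let ?M = jordan_recognizer
  let ?P = "word_prob ?M"
  note M = stochastic_jordan_recognizer
  have P_pos: "0 < ?P w" if "w \<in> lists (alphabet ?M)" for w
    using that state_prob_jordan_recognizer_pos[of w] word_prob_eq_state_prob[OF M that] by simp
  have P_rep: "?P (replicate n 0) = (real n + 2) / 2 ^ Suc n" for n
  proof -
    have "?P (replicate n 0) = state_prob ?M (replicate n 0) 0"
      by (rule word_prob_eq_state_prob[OF M]) auto
    then show ?thesis using state_prob_jordan_recognizer_replicate[of n] by simp
  qed
  have "\<not> generates G ?P" if G: "stochastic_deterministic_generator G" for G :: "nat machine"
  proof
    assume "generates G ?P"
    then have P: "?P = word_prob G" by (simp add: generates_def)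
    \<comment> \<open>The alphabet of \<open>G\<close> is not given in advance, but
      \<open>word_prob\<close> vanishes on words outside it.\<close>
    have "word_prob G [0] \<noteq> 0" using P_pos[of "[0]"] P by simp
    then have zero: "0 \<in> alphabet G" by (auto simp: word_prob_def split: if_splits)
    \<comment> \<open>This is the quotient of the values in \<open>P_rep\<close> at n + 1 and n, the
      conditional probability of a further 0.\<close>
    let ?r = "\<lambda>n. (real n + 3) / (2 * (real n + 2))"
    have "?r n \<in> (\<lambda>i. state_prob G [0] i) ` {..<num_states G}" for n
    proof -
      obtain i where i: "i < num_states G"
        "word_prob G (replicate (Suc n) 0) = word_prob G (replicate n 0) * state_prob G [0] i"
        using deterministic_replicate[OF G zero] by blast
      \<comment> \<open>The left side is arranged so that both ends of the chain have the divisor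
        \<open>2 ^ Suc n\<close>, which then cancels.\<close>
      have "(real n + 3) / 2 / 2 ^ Suc n = (real (Suc n) + 2) / 2 ^ Suc (Suc n)"
        by simp
      also have "\<dots> = (real n + 2) / 2 ^ Suc n * state_prob G [0] i"
        using i(2) by (simp only: P[symmetric] P_rep)
      also have "\<dots> = (real n + 2) * state_prob G [0] i / 2 ^ Suc n"
        by simp
      finally have "(real n + 3) / 2 = (real n + 2) * state_prob G [0] i"
        by (subst (asm) divide_cancel_right) simp
      then have "?r n = state_prob G [0] i" by (simp add: divide_eq_eq)
      with i(1) show ?thesis by auto
    qed
    then have "range ?r \<subseteq> (\<lambda>i. state_prob G [0] i) ` {..<num_states G}" by blast
    then have "finite (range ?r)" by (rule finite_subset) simp
    \<comment> \<open>The value at n is 1/2 + 1/(2(n+2)), which strictly decreases in n.\<close>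
    moreover have "inj ?r" by (rule injI) (simp add: field_simps)
    ultimately show False using finite_imageD infinite_UNIV_nat by blast
  qed
  moreover have "process_language (alphabet ?M) ?P"
    using M P_pos by (rule process_language_word_prob)
  ultimately show ?thesis
    using M by (intro exI[of _ ?M] exI[of _ ?P]) (auto simp: recognizes_def)
qed

end
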